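(* Let $N$ be a positive integer. For all integers $k\ge 1$ and all real numbers $x\ge 1$, the product of the $k$th Fibonacci polynomial $F_k(x)$ with the periodic continued fraction $[\overline{2N,\,x^{(k-1)}}]$ satisfies: if $k$ is odd, then $$F_k(x)\cdot[\overline{2N,\,x^{(k-1)}}]=[2NF_k(x)+F_{k-1}(x),\ \overline{2NF_k(x)+2F_{k-1}(x)}],$$ and if $k$ is even, then $$F_k(x)\cdot[\overline{2N,\,x^{(k-1)}}]=[2NF_k(x)+F_{k-1}(x)-1,\ \overline{1,\ 2NF_k(x)+2F_{k-1}(x)-2}].$$
   Context: The Fibonacci polynomials $F_k(x)$ are defined by the generating function $\frac{t}{1-xt-t^2}=\sum_{k\ge1}F_k(x)t^k$; equivalently $F_0(x)=0$, $F_1(x)=1$, $F_{k+1}(x)=xF_k(x)+F_{k-1}(x)$. The notation $[a_0,a_1,a_2,\dots]$ (with real entries) denotes the continued fraction $a_0+\cfrac{1}{a_1+\cfrac{1}{a_2+\cdots}}$, i.e. the limit of its convergents. An overline denotes a block repeated indefinitely: $[a_0,\overline{b_1,\dots,b_s}]$, or $[\overline{b_1,\dots,b_s}]$ in the purely periodic case. $x^{(j)}$ denotes the string $x,x,\dots,x$ of $j$ copies of $x$ (empty if $j=0$). *)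

theory Defs
  imports
    Complex_Main
    "HOL-Library.Stream"
    "HOL-Computational_Algebra.Polynomial"
begin

fun fib_poly :: "nat \<Rightarrow> real poly" where
  "fib_poly 0 = 0"
| "fib_poly (Suc 0) = 1"
| "fib_poly (Suc (Suc k)) = [:0, 1:] * fib_poly (Suc k) + fib_poly k"

text \<open>
  \<open>cf_convergent s n\<close> is the finite continued fraction \<open>[s\<^sub>0, \<dots>, s\<^sub>n]\<close>. Since
  \<open>1 / 0 = 0\<close> in HOL, this is the intended value only if no denominator vanishes, for instance
  if all entries after the first are positive.
\<close>
primrec cf_convergent :: "real stream \<Rightarrow> nat \<Rightarrow> real" where
  "cf_convergent s 0 = shd s"
| "cf_convergent s (Suc n) = shd s + 1 / cf_convergent (stl s) n"

definition cf_converges :: "real stream \<Rightarrow> bool" where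
  "cf_converges s \<longleftrightarrow> convergent (cf_convergent s)"

text \<open>
  Meaningful only under \<^const>\<open>cf_converges\<close>. The continued fraction with initial block \<open>as\<close> and
  repeated block \<open>bs\<close> is \<open>cf_value (as @- cycle bs)\<close>, for nonempty \<open>bs\<close>.
\<close>
definition cf_value :: "real stream \<Rightarrow> real" where
  "cf_value s = lim (cf_convergent s)"

end

theory Submission
  imports Defs
begin

text \<open>
  Two steps \<open>y \<mapsto> a + 1 / (b + 1 / y)\<close> contract \<open>[1, \<infinity>)\<close> by the factor \<open>1/4\<close> when
  \<open>a, b \<ge> 1\<close>, so every continued fraction with entries at least \<open>1\<close> converges. Hence both sides
  may be evaluated by unrolling one period. By Cassini's identity both are positive roots of
  \<open>z\<^sup>2 - 2 N F\<^sub>k z - (2 N F\<^sub>k F\<^sub>k\<^sub>-\<^sub>1 + F\<^sub>k\<^sub>-\<^sub>1\<^sup>2 - (-1)\<^sup>k)\<close>; the constant term is negative, so this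
  polynomial has only one positive root.
\<close>

section \<open>Convergence of continued fractions with entries at least 1\<close>

lemma cf_convergent_bounds:
  assumes "\<forall>a\<in>sset s. 1 \<le> a"
  shows "shd s \<le> cf_convergent s n \<and> cf_convergent s n \<le> shd s + 1"
  using assms
proof (induction n arbitrary: s)
  case 0
  then show ?case by simp
next
  case (Suc n)
  have tl: "\<forall>a\<in>sset (stl s). 1 \<le> a"
    using Suc.prems by (cases s) auto
  have "1 \<le> shd (stl s)"
    using tl by (cases "stl s") auto
  with Suc.IH[OF tl] have "1 \<le> cf_convergent (stl s) n"
    by linarith
  then show ?case by simp
qed

lemma cf_convergent_ge_1:
  assumes "\<forall>a\<in>sset s. 1 \<le> a"
  shows "1 \<le> cf_convergent s n"
proof -
  have "1 \<le> shd s"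
    using assms by (cases s) auto
  with cf_convergent_bounds[OF assms, of n] show ?thesis
    by linarith
qed

text \<open>The difference equals \<open>(y - z) / ((b * y + 1) * (b * z + 1))\<close>, and both
  factors are at least 2. Two steps are taken together because the single step
  \<open>a + 1 / y\<close> has slope -1 at \<open>y = 1\<close>.\<close>

lemma two_step_contraction:
  fixes a b y z :: real
  assumes "1 \<le> b" "1 \<le> y" "1 \<le> z"
  shows "\<bar>(a + 1 / (b + 1 / y)) - (a + 1 / (b + 1 / z))\<bar> \<le> \<bar>y - z\<bar> / 4"
proof -
  have by1: "1 \<le> b * y" and bz1: "1 \<le> b * z"
    using mult_mono[of 1 b 1 y] mult_mono[of 1 b 1 z] assms by auto
  have 4: "4 \<le> (b * y + 1) * (b * z + 1)"
    using mult_mono[of 2 "b * y + 1" 2 "b * z + 1"] by1 bz1 by auto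
  have step: "1 / (b + 1 / w) = w / (b * w + 1)" if "1 \<le> w" for w
    using that by (simp add: field_simps)
  have "(a + 1 / (b + 1 / y)) - (a + 1 / (b + 1 / z)) = y / (b * y + 1) - z / (b * z + 1)"
    using step assms by simp
  also have "\<dots> = (y - z) / ((b * y + 1) * (b * z + 1))"
    using by1 bz1 by (simp add: diff_frac_eq algebra_simps)
  finally have "\<bar>(a + 1 / (b + 1 / y)) - (a + 1 / (b + 1 / z))\<bar>
      = \<bar>y - z\<bar> / ((b * y + 1) * (b * z + 1))"
    using 4 by (simp only: abs_divide)
  also have "\<dots> \<le> \<bar>y - z\<bar> / 4"
    using 4 by (intro divide_left_mono) auto
  finally show ?thesis .
qed

text \<open>Stripping two leading entries from both convergents gains a factor 1/4, and indices of
  at least \<open>2 * j\<close> allow this \<open>j\<close> times. At the start, all convergents lie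
  in one interval of length 1.\<close>

lemma cf_convergent_diff_le:
  assumes "\<forall>a\<in>sset s. 1 \<le> a" "2 * j \<le> m" "2 * j \<le> n"
  shows "\<bar>cf_convergent s m - cf_convergent s n\<bar> \<le> (1 / 4) ^ j"
  using assms
proof (induction j arbitrary: s m n)
  case 0
  then show ?case
    using cf_convergent_bounds[of s m] cf_convergent_bounds[of s n] by (simp add: abs_le_iff)
next
  case (Suc j)
  obtain m' n' where mn: "m = Suc (Suc m')" "n = Suc (Suc n')" "2 * j \<le> m'" "2 * j \<le> n'"
    using Suc.prems(2,3) by (cases m; cases "m - 1"; cases n; cases "n - 1") auto
  let ?t = "stl (stl s)"
  have tl: "\<forall>a\<in>sset ?t. 1 \<le> a" and b: "1 \<le> shd (stl s)"
    using Suc.prems(1) by (auto intro: stl_sset shd_sset)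
  have "\<bar>cf_convergent s m - cf_convergent s n\<bar>
      \<le> \<bar>cf_convergent ?t m' - cf_convergent ?t n'\<bar> / 4"
    unfolding mn(1,2) cf_convergent.simps
    using b tl by (intro two_step_contraction cf_convergent_ge_1)
  with Suc.IH[OF tl mn(3,4)] show ?case
    by simp
qed

lemma cf_converges_of_ge_1:
  assumes "\<forall>a\<in>sset s. 1 \<le> a"
  shows "cf_converges s"
  unfolding cf_converges_def
proof (intro Cauchy_convergent CauchyI)
  fix e :: real
  assume "0 < e"
  then obtain j where j: "(1 / 4 :: real) ^ j < e"
    using real_arch_pow_inv[of e "1 / 4"] by auto
  show "\<exists>M. \<forall>m\<ge>M. \<forall>n\<ge>M. norm (cf_convergent s m - cf_convergent s n) < e"
  proof (intro exI[of _ "2 * j"] allI impI)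
    fix m n
    assume "2 * j \<le> m" "2 * j \<le> n"
    from cf_convergent_diff_le[OF assms this] j
    show "norm (cf_convergent s m - cf_convergent s n) < e"
      by simp
  qed
qed

section \<open>Values of continued fractions and unrolling of entries\<close>

lemma cf_convergent_tendsto_value:
  assumes "cf_converges s"
  shows "cf_convergent s \<longlonglongrightarrow> cf_value s"
  using assms unfolding cf_converges_def cf_value_def by (simp add: convergent_LIMSEQ_iff)

lemma cf_value_ge_1:
  assumes "\<forall>a\<in>sset s. 1 \<le> a"
  shows "1 \<le> cf_value s"
  using cf_convergent_tendsto_value[OF cf_converges_of_ge_1[OF assms]]
  by (rule LIMSEQ_le_const) (use cf_convergent_ge_1[OF assms] in blast)

text \<open>Pass to the limit in the recursion for convergents; the reciprocal is continuous there
  because the value of the tail is at least 1.\<close>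

lemma cf_value_SCons:
  assumes "\<forall>b\<in>sset s. 1 \<le> b" "1 \<le> a"
  shows "cf_value (a ## s) = a + 1 / cf_value s"
proof (rule LIMSEQ_unique)
  have "\<forall>b\<in>sset (a ## s). 1 \<le> b"
    using assms by simp
  then show "(\<lambda>n. cf_convergent (a ## s) (Suc n)) \<longlonglongrightarrow> cf_value (a ## s)"
    by (intro LIMSEQ_Suc cf_convergent_tendsto_value cf_converges_of_ge_1)
  have "cf_value s \<noteq> 0"
    using cf_value_ge_1[OF assms(1)] by simp
  then show "(\<lambda>n. cf_convergent (a ## s) (Suc n)) \<longlonglongrightarrow> a + 1 / cf_value s"
    unfolding cf_convergent.simps stream.sel
    by (intro tendsto_intros cf_convergent_tendsto_value cf_converges_of_ge_1[OF assms(1)])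
qed

lemma cycle_Cons_eq: "cycle (a # bs) = a ## (bs @- cycle (a # bs))"
  using cycle_decomp[of "a # bs"] by simp

section \<open>Fibonacci polynomials and blocks of equal entries\<close>

lemma poly_fib_poly_Suc_Suc:
  "poly (fib_poly (Suc (Suc k))) x = x * poly (fib_poly (Suc k)) x + poly (fib_poly k) x"
  by simp

lemma poly_fib_poly_ge:
  assumes "1 \<le> x"
  shows "0 \<le> poly (fib_poly k) x \<and> 1 \<le> poly (fib_poly (Suc k)) x"
proof (induction k)
  case 0
  then show ?case by simp
next
  case (Suc k)
  have "1 \<le> x * poly (fib_poly (Suc k)) x"
    using mult_mono[of 1 x 1 "poly (fib_poly (Suc k)) x"] Suc assms by simp
  with Suc show ?case
    unfolding poly_fib_poly_Suc_Suc by linarith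
qed

lemma fib_poly_cassini:
  "poly (fib_poly (Suc (Suc k))) x * poly (fib_poly k) x
    = (poly (fib_poly (Suc k)) x)\<^sup>2 - (-1) ^ k"
proof (induction k)
  case 0
  then show ?case by simp
next
  case (Suc k)
  let ?a = "poly (fib_poly k) x" and ?b = "poly (fib_poly (Suc k)) x"
  have "(x * ?b + ?a) * ?a = ?b\<^sup>2 - (-1) ^ k"
    using Suc unfolding poly_fib_poly_Suc_Suc .
  \<comment> \<open>With \<open>c = x * ?b + ?a\<close> one has
    \<open>c * c - x * c * ?b = c * ?a\<close>, to which the induction hypothesis applies.\<close>
  then have "(x * (x * ?b + ?a) + ?b) * ?b = (x * ?b + ?a)\<^sup>2 - (-1) ^ Suc k"
    by (simp add: power2_eq_square algebra_simps)
  then show ?case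
    unfolding poly_fib_poly_Suc_Suc .
qed

text \<open>Prepending \<open>x\<close> acts on the tail value as the Moebius map with matrix rows
  (x, 1) and (1, 0). The entries of the powers of this matrix are Fibonacci polynomials.\<close>

lemma cf_value_replicate_shift:
  assumes "\<forall>a\<in>sset s. 1 \<le> a" "1 \<le> x"
  defines "F \<equiv> \<lambda>j. poly (fib_poly j) x"
  shows "cf_value (replicate (Suc m) x @- s)
    = (F (Suc (Suc m)) * cf_value s + F (Suc m)) / (F (Suc m) * cf_value s + F m)"
proof (induction m)
  case 0
  have "cf_value s \<noteq> 0"
    using cf_value_ge_1[OF assms(1)] by simp
  then show ?case
    using cf_value_SCons[OF assms(1,2)] by (simp add: F_def field_simps)
next
  case (Suc m)
  have ge: "\<forall>a\<in>sset (replicate (Suc m) x @- s). 1 \<le> a"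
    using assms(1,2) by auto
  have F_ge: "0 \<le> F j" "1 \<le> F (Suc j)" for j
    using poly_fib_poly_ge[OF assms(2), of j] by (auto simp: F_def)
  have "0 < F (Suc j) * cf_value s + F j" for j
    using F_ge[of j] cf_value_ge_1[OF assms(1)] by (intro add_pos_nonneg mult_pos_pos) auto
  from this[of m] this[of "Suc m"]
  have "x + 1 / ((F (Suc (Suc m)) * cf_value s + F (Suc m)) / (F (Suc m) * cf_value s + F m))
    = (x * (F (Suc (Suc m)) * cf_value s + F (Suc m)) + (F (Suc m) * cf_value s + F m))
      / (F (Suc (Suc m)) * cf_value s + F (Suc m))"
    by (simp add: field_simps)
  also have "\<dots> = (F (Suc (Suc (Suc m))) * cf_value s + F (Suc (Suc m)))
      / (F (Suc (Suc m)) * cf_value s + F (Suc m))"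
    unfolding F_def poly_fib_poly_Suc_Suc by (simp add: algebra_simps)
  finally show ?case
    using cf_value_SCons[OF ge assms(2)] Suc by simp
qed

section \<open>Quadratic equations for both sides\<close>

lemma positive_root_unique:
  fixes p q y z :: real
  assumes "0 < q" "0 < y" "0 < z" "y\<^sup>2 - p * y = q" "z\<^sup>2 - p * z = q"
  shows "y = z"
proof -
  have "y * (y - p) = q" "z * (z - p) = q"
    using assms(4,5) by (simp_all add: power2_eq_square algebra_simps)
  then have "0 < y - p"
    using assms(1,2) by (metis zero_less_mult_pos)
  then have "0 < y + z - p"
    using assms(3) by linarith
  moreover have "(y - z) * (y + z - p) = 0"
    using assms(4,5) by (simp add: power2_eq_square algebra_simps)
  ultimately show ?thesis
    by simp
qed

text \<open>Unrolling a whole period expresses the value as a Moebius function of itself. Here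
  \<open>Suc (Suc m)\<close> is the index k of the theorem, so the sign is that of k.\<close>

lemma fib_poly_mult_cf_value_quadratic:
  fixes a x :: real and m :: nat
  assumes "1 \<le> a" "1 \<le> x"
  defines "F \<equiv> \<lambda>j. poly (fib_poly j) x"
  defines "A \<equiv> F (Suc (Suc m)) * cf_value (cycle (a # replicate (Suc m) x))"
  shows "A\<^sup>2 - a * F (Suc (Suc m)) * A
    = a * F (Suc (Suc m)) * F (Suc m) + (F (Suc m))\<^sup>2 - (-1) ^ m"
proof -
  let ?s = "cycle (a # replicate (Suc m) x)"
  let ?F2 = "F (Suc (Suc m))" and ?F1 = "F (Suc m)" and ?F0 = "F m"
  define v where "v = cf_value ?s"
  have ge: "\<forall>b\<in>sset ?s. 1 \<le> b"
    using assms(1,2) by (simp add: sset_cycle)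
  then have ge': "\<forall>b\<in>sset (replicate (Suc m) x @- ?s). 1 \<le> b"
    using assms(2) by auto
  have v1: "1 \<le> v"
    unfolding v_def by (rule cf_value_ge_1[OF ge])
  have "v = a + 1 / cf_value (replicate (Suc m) x @- ?s)"
    unfolding v_def by (subst cycle_Cons_eq, rule cf_value_SCons[OF ge' assms(1)])
  also have "\<dots> = a + (?F1 * v + ?F0) / (?F2 * v + ?F1)"
    unfolding cf_value_replicate_shift[OF ge assms(2)] F_def v_def by simp
  finally have v: "v = a + (?F1 * v + ?F0) / (?F2 * v + ?F1)" .
  have "0 < ?F2 * v + ?F1"
    using poly_fib_poly_ge[OF assms(2), of "Suc m"] v1 unfolding F_def
    by (intro add_pos_nonneg mult_pos_pos) auto
  with v have "(v - a) * (?F2 * v + ?F1) = ?F1 * v + ?F0"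
    by (metis add_diff_cancel_left' less_irrefl nonzero_eq_divide_eq)
  \<comment> \<open>The factor \<open>?F2\<close> makes the equation monic in \<open>A\<close> and
    creates the product \<open>?F2 * ?F0\<close> for Cassini's identity. The terms
    \<open>?F1 * A\<close> cancel.\<close>
  then have "?F2 * ((v - a) * (?F2 * v + ?F1)) = ?F2 * (?F1 * v + ?F0)"
    by simp
  moreover have "?F2 * ?F0 = ?F1\<^sup>2 - (-1) ^ m"
    unfolding F_def by (rule fib_poly_cassini)
  ultimately show ?thesis
    unfolding A_def v_def[symmetric] by (simp add: power2_eq_square algebra_simps)
qed

text \<open>If \<open>v\<close> is the value of the periodic part, then \<open>d = 1 / v\<close>,
  while unrolling one period gives \<open>v = c + d\<close>.\<close>

lemma cf_value_period_1:
  fixes b c :: real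
  assumes "1 \<le> b" "1 \<le> c"
  defines "d \<equiv> cf_value ([b] @- cycle [c]) - b"
  shows "(d + c) * d = 1"
proof -
  define v where "v = cf_value (cycle [c])"
  have ge: "\<forall>a\<in>sset (cycle [c]). 1 \<le> a"
    using assms(2) by (simp add: sset_cycle)
  have v1: "1 \<le> v"
    unfolding v_def by (rule cf_value_ge_1[OF ge])
  have "v = c + 1 / v"
    unfolding v_def by (subst cycle_Cons_eq) (simp add: cf_value_SCons[OF ge assms(2)])
  moreover have d: "d = 1 / v"
    unfolding d_def v_def by (simp add: cf_value_SCons[OF ge assms(1)])
  ultimately have "d + c = v"
    by simp
  with d v1 show ?thesis
    by simp
qed

text \<open>Again \<open>d = 1 / v\<close>, and unrolling both entries of the period gives
  \<open>v = 1 + 1 / (c + d)\<close>; eliminate \<open>v\<close>.\<close>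

lemma cf_value_period_2:
  fixes b c :: real
  assumes "1 \<le> b" "1 \<le> c"
  defines "d \<equiv> cf_value ([b] @- cycle [1, c]) - b"
  shows "d\<^sup>2 + c * d = c"
proof -
  define v where "v = cf_value (cycle [1, c])"
  have ge: "\<forall>a\<in>sset (cycle [1, c]). 1 \<le> a"
    using assms(2) by (simp add: sset_cycle)
  then have ge': "\<forall>a\<in>sset (c ## cycle [1, c]). 1 \<le> a"
    using assms(2) by simp
  have v1: "1 \<le> v"
    unfolding v_def by (rule cf_value_ge_1[OF ge])
  have d: "d = 1 / v"
    unfolding d_def v_def by (simp add: cf_value_SCons[OF ge assms(1)])
  have "v = 1 + 1 / cf_value (c ## cycle [1, c])"
    unfolding v_def by (subst cycle_Cons_eq) (simp add: cf_value_SCons[OF ge'])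
  also have "\<dots> = 1 + 1 / (c + d)"
    by (simp add: cf_value_SCons[OF ge assms(2)] v_def d)
  finally have "v = 1 + 1 / (c + d)" .
  moreover have d0: "0 < d"
    using d v1 by simp
  ultimately have "v * (c + d) = c + d + 1"
    using assms(2) by (simp add: field_simps)
  then have "d * (v * (c + d)) = d * (c + d + 1)"
    by simp
  moreover have "d * v = 1"
    using d v1 by simp
  then have "d * (v * (c + d)) = c + d"
    by (metis mult.assoc mult_1)
  ultimately show ?thesis
    by (simp add: power2_eq_square algebra_simps)
qed

theorem theorem6:
  fixes N k :: nat and x :: real
  assumes "N \<ge> 1" and "k \<ge> 1" and "x \<ge> 1"
  defines "F \<equiv> \<lambda>j. poly (fib_poly j) x"
  defines "\<alpha> \<equiv> cycle (2 * real N # replicate (k - 1) x)"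
  defines "\<beta> \<equiv> [2 * real N * F k + F (k - 1)] @- cycle [2 * real N * F k + 2 * F (k - 1)]"
  defines "\<gamma> \<equiv> [2 * real N * F k + F (k - 1) - 1] @- cycle [1, 2 * real N * F k + 2 * F (k - 1) - 2]"
  shows "cf_converges \<alpha> \<and>
         (odd k \<longrightarrow> cf_converges \<beta> \<and> F k * cf_value \<alpha> = cf_value \<beta>) \<and>
         (even k \<longrightarrow> cf_converges \<gamma> \<and> F k * cf_value \<alpha> = cf_value \<gamma>)"
proof -
  have a2: "2 \<le> 2 * real N"
    using assms(1) by simp
  then have a1: "1 \<le> 2 * real N"
    by linarith
  have ge_\<alpha>: "\<forall>a\<in>sset \<alpha>. 1 \<le> a"
    using a1 assms(3) by (auto simp: \<alpha>_def sset_cycle)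
  then have conv: "cf_converges \<alpha>"
    by (rule cf_converges_of_ge_1)
  show ?thesis
  \<comment> \<open>For \<open>k = 1\<close> the block of copies of \<open>x\<close> is empty, and
    \<beta> is \<alpha> with one period written out. Otherwise there is at least one copy, as the
    block formula requires.\<close>
  proof (cases "k = 1")
    case True
    then have "\<alpha> = \<beta>"
      using cycle_Cons_eq[of "2 * real N" "[]"] by (simp add: \<alpha>_def \<beta>_def F_def)
    with True conv show ?thesis
      by (simp add: F_def)
  next
    case False
    with assms(2) obtain m where k: "k = Suc (Suc m)"
      by (metis One_nat_def Suc_le_D not0_implies_Suc)
    define a where "a = 2 * real N"
    define F2 where "F2 = F k"
    define F1 where "F1 = F (k - 1)"
    have F1: "1 \<le> F1" and F2: "1 \<le> F2"
      using poly_fib_poly_ge[OF assms(3), of m] poly_fib_poly_ge[OF assms(3), of "Suc m"]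
      by (auto simp: F1_def F2_def F_def k)
    \<comment> \<open>Together with \<open>1 \<le> F1\<close> this keeps all entries of \<beta> and
      \<gamma> at least 1, even those with 1 or 2 subtracted.\<close>
    have aF2: "2 \<le> a * F2"
      using mult_mono[of 2 a 1 F2] a2 F2 by (simp add: a_def)
    define A where "A = F2 * cf_value \<alpha>"
    have A0: "0 < A"
      using F2 cf_value_ge_1[OF ge_\<alpha>] by (simp add: A_def)
    have A: "A\<^sup>2 - (a * F2) * A = a * F2 * F1 + F1\<^sup>2 - (-1) ^ m"
      using fib_poly_mult_cf_value_quadratic[OF a1 assms(3), of m]
      by (simp add: A_def F2_def F1_def F_def \<alpha>_def a_def k)
    have F1sq: "1 \<le> F1\<^sup>2"
      using F1 by simp
    have "0 < a * F2 * F1"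
      using aF2 F1 by simp
    then have pos: "0 < a * F2 * F1 + F1\<^sup>2 - 1" "0 < a * F2 * F1 + F1\<^sup>2 + 1"
      using F1sq by linarith+
    have odd: "cf_converges \<beta> \<and> A = cf_value \<beta>" if "odd k"
    proof -
      have \<beta>: "\<beta> = [a * F2 + F1] @- cycle [a * F2 + 2 * F1]"
        by (simp add: \<beta>_def a_def F2_def F1_def)
      have b1: "1 \<le> a * F2 + F1" and c1: "1 \<le> a * F2 + 2 * F1"
        using aF2 F1 by linarith+
      have ge: "\<forall>a\<in>sset \<beta>. 1 \<le> a"
        using b1 c1 by (simp add: \<beta> sset_cycle)
      have "(cf_value \<beta> - (a * F2 + F1) + (a * F2 + 2 * F1)) * (cf_value \<beta> - (a * F2 + F1)) = 1"
        using cf_value_period_1[OF b1 c1] by (simp only: \<beta>)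
      \<comment> \<open>The product above is \<open>(z + F1) * (z - a * F2 - F1)\<close> for
        \<open>z = cf_value \<beta>\<close>.\<close>
      then have "(cf_value \<beta>)\<^sup>2 - (a * F2) * cf_value \<beta> = a * F2 * F1 + F1\<^sup>2 + 1"
        by (simp add: power2_eq_square algebra_simps)
      moreover have "A\<^sup>2 - (a * F2) * A = a * F2 * F1 + F1\<^sup>2 + 1"
        using A that by (simp add: k)
      ultimately have "A = cf_value \<beta>"
        using positive_root_unique[OF pos(2) A0] cf_value_ge_1[OF ge] by simp
      with cf_converges_of_ge_1[OF ge] show ?thesis
        by simp
    qed
    have even: "cf_converges \<gamma> \<and> A = cf_value \<gamma>" if "even k"
    proof -
      have \<gamma>: "\<gamma> = [a * F2 + F1 - 1] @- cycle [1, a * F2 + 2 * F1 - 2]"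
        by (simp add: \<gamma>_def a_def F2_def F1_def)
      have b1: "1 \<le> a * F2 + F1 - 1" and c1: "1 \<le> a * F2 + 2 * F1 - 2"
        using aF2 F1 by linarith+
      have ge: "\<forall>a\<in>sset \<gamma>. 1 \<le> a"
        using b1 c1 by (simp add: \<gamma> sset_cycle)
      have "(cf_value \<gamma> - (a * F2 + F1 - 1))\<^sup>2
          + (a * F2 + 2 * F1 - 2) * (cf_value \<gamma> - (a * F2 + F1 - 1)) = a * F2 + 2 * F1 - 2"
        using cf_value_period_2[OF b1 c1] by (simp only: \<gamma>)
      \<comment> \<open>With \<open>u = F1 - 1\<close> and \<open>z = cf_value \<gamma>\<close>, the
        equation above reads \<open>(z + u) * (z - a * F2 - u) = a * F2 + 2 * u\<close>; the
        constant uses \<open>u * u + 2 * u = F1 * F1 - 1\<close>.\<close>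
      then have "(cf_value \<gamma>)\<^sup>2 - (a * F2) * cf_value \<gamma> = a * F2 * F1 + F1\<^sup>2 - 1"
        by (simp add: power2_eq_square algebra_simps)
      moreover have "A\<^sup>2 - (a * F2) * A = a * F2 * F1 + F1\<^sup>2 - 1"
        using A that by (simp add: k)
      ultimately have "A = cf_value \<gamma>"
        using positive_root_unique[OF pos(1) A0] cf_value_ge_1[OF ge] by simp
      with cf_converges_of_ge_1[OF ge] show ?thesis
        by simp
    qed
    show ?thesis
      using conv odd even by (simp add: A_def F2_def)
  qed
qed

end
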